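(* For every $e\in\mathsf{Exp}$, $$e\equiv_0\bigoplus_{d\in\operatorname{supp}(\partial(e))}\partial(e)(d)\cdot \mathrm{ex}(d),$$ where $\mathrm{ex}:F\mathsf{Exp}\to\mathsf{Exp}$ is given by $\mathrm{ex}(\checkmark)=\mathsf{1}$ and $\mathrm{ex}(a,e')=a;e'$.
   Context: Fix a finite alphabet $A$. Probabilistic regular expressions: $e,f ::= \mathsf{0}\mid\mathsf{1}\mid a\ (a\in A)\mid e\oplus_pf\mid e;f\mid e^{[p]}$, $p\in[0,1]$; $\mathsf{Exp}$ is the set of them. $\mathcal{D}X$: finitely supported subdistributions on $X$; $\delta_x$ Dirac; $0$ empty subdistribution; $\operatorname{supp}(\nu)=\{x:\nu(x)>0\}$. $FX=\{\checkmark\}+A\times X$. Antimirov derivative $\partial:\mathsf{Exp}\to\mathcal{D}F\mathsf{Exp}$: $\partial(\mathsf{0})=0$, $\partial(\mathsf{1})=\delta_\checkmark$, $\partial(a)=\delta_{(a,\mathsf{1})}$, $\partial(e\oplus_pf)=p\partial(e)+(1-p)\partial(f)$; $\partial(e;f)(\checkmark)=\partial(e)(\checkmark)\partial(f)(\checkmark)$, $\partial(e;f)(a,g)=\partial(e)(\checkmark)\partial(f)(a,g)+\sum_{e':\,e';f=g}\partial(e)(a,e')$; if $p=1$ and $\partial(e)(\checkmark)=1$ then $\partial(e^{[p]})=0$, otherwise $\partial(e^{[p]})(\checkmark)=\frac{1-p}{1-p\partial(e)(\checkmark)}$, $\partial(e^{[p]})(a,e';e^{[p]})=\frac{p\partial(e)(a,e')}{1-p\partial(e)(\checkmark)}$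 and $0$ elsewhere. Termination $E:\mathsf{Exp}\to[0,1]$: $E(\mathsf{1})=1$, $E(\mathsf{0})=E(a)=0$, $E(e\oplus_pf)=pE(e)+(1-p)E(f)$, $E(e;f)=E(e)E(f)$, $E(e^{[p]})=0$ if $E(e)=1,p=1$, else $\frac{1-p}{1-pE(e)}$. $\bar p=1-p$. $\equiv_0$ is the least congruence on $\mathsf{Exp}$ containing, for all $e,f,g$, $p,q$ (division instances only for nonzero denominators): (C1) $e\equiv_0 e\oplus_pe$; (C2) $e\equiv_0 e\oplus_1f$; (C3) $e\oplus_pf\equiv_0 f\oplus_{\bar p}e$; (C4) $(e\oplus_pf)\oplus_qg\equiv_0 e\oplus_{pq}(f\oplus_{\frac{\bar pq}{1-pq}}g)$; (D1) $(e\oplus_pf);g\equiv_0 e;g\oplus_pf;g$; (0S) $\mathsf{0};e\equiv_0\mathsf{0}$; (1S) $\mathsf{1};e\equiv_0 e$; (S1) $e;\mathsf{1}\equiv_0 e$; (S) $e;(f;g)\equiv_0(e;f);g$; (Unroll) $e;e^{[p]}\oplus_p\mathsf{1}\equiv_0 e^{[p]}$; (Tight) $(e\oplus_p\mathsf{1})^{[q]};\mathsf{1}\equiv_0 e^{[\frac{pq}{1-\bar pq}]}$; (Div) $\mathsf{1}^{[1]}\equiv_0\mathsf{0}$; and closed under (Unique): if $g\equiv_0 e;g\oplus_pf$ and $E(e)=0$ then $g\equiv_0 e^{[p]};f$. (It omits the axioms $e;\mathsf{0}\equiv\mathsf{0}$ and $e;(f\oplus_pg)\equiv e;f\oplus_pe;g$.)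 $n$-ary choice: for finite $I$ and $p_i\in[0,1]$ with $\sum_ip_i\le1$, $\bigoplus_{i\in I}p_i\cdot e_i$ is $\mathsf{0}$ if $I=\emptyset$; $e_k$ if $p_k=1$ for some $k$; otherwise $e_k\oplus_{p_k}\big(\bigoplus_{i\in I\setminus\{k\}}\frac{p_i}{1-p_k}\cdot e_i\big)$ for a chosen $k\in I$ (different choices give $\equiv_0$-equivalent expressions). *)

theory Defs
  imports Complex_Main
begin

typedef prob = "{0..1::real}"
  morphisms pval Abs_prob
  by (intro exI[of _ 0]) simp

text \<open>
  Truncation to the unit interval makes \<open>prob_of\<close> total. It is only meant to be applied to reals
  in the unit interval, where it is inverse to \<open>pval\<close>; the lemmas about ranges
  below show that the truncation is never active in the uses made of it.
\<close>

definition prob_of :: "real \<Rightarrow> prob" where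
  "prob_of x = Abs_prob (max 0 (min 1 x))"

lemma pval_prob_of: "0 \<le> x \<Longrightarrow> x \<le> 1 \<Longrightarrow> pval (prob_of x) = x"
  by (simp add: prob_of_def Abs_prob_inverse)

lemma prob_of_pval: "prob_of (pval p) = p"
  using pval[of p] by (simp add: prob_of_def pval_inverse)

lemma pval_ge_0 [simp]: "0 \<le> pval p" and pval_le_1 [simp]: "pval p \<le> 1"
  using pval[of p] by auto

datatype 'a pexp =
    PZero
  | POne
  | PAct 'a
  | PChoice "'a pexp" prob "'a pexp"  ("_ \<oplus>\<^bsub>_\<^esub> _" [71, 0, 70] 70)
  | PSeq "'a pexp" "'a pexp"  (infixr ";;" 75)
  | PLoop "'a pexp" prob  ("_\<^bsup>[_]\<^esup>" [1000, 0] 1000)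

datatype ('a, 'x) F = Tick | Step 'a 'x

definition supp :: "('x \<Rightarrow> real) \<Rightarrow> 'x set" where
  "supp \<nu> = {x. \<nu> x > 0}"

definition subdist :: "('x \<Rightarrow> real) \<Rightarrow> bool" where
  "subdist \<nu> \<longleftrightarrow> (\<forall>x. 0 \<le> \<nu> x) \<and> finite (supp \<nu>) \<and> sum \<nu> (supp \<nu>) \<le> 1"

definition dirac :: "'x \<Rightarrow> 'x \<Rightarrow> real" where
  "dirac x = (\<lambda>y. if y = x then 1 else 0)"

text \<open>
  Antimirov derivatives, as real-valued functions; \<open>subdist_deriv\<close> below shows that they are
  finitely supported subdistributions. The sum in the clause for sequential composition has at
  most one summand, by injectivity of \<open>;;\<close>.
\<close>

primrec deriv :: "'a pexp \<Rightarrow> ('a, 'a pexp) F \<Rightarrow> real" ("\<partial>") where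
  "\<partial> PZero = (\<lambda>_. 0)"
| "\<partial> POne = dirac Tick"
| "\<partial> (PAct a) = dirac (Step a POne)"
| "\<partial> (e \<oplus>\<^bsub>p\<^esub> f) = (\<lambda>d. pval p * \<partial> e d + (1 - pval p) * \<partial> f d)"
| "\<partial> (e ;; f) = (\<lambda>d. case d of
      Tick \<Rightarrow> \<partial> e Tick * \<partial> f Tick
    | Step a g \<Rightarrow> \<partial> e Tick * \<partial> f (Step a g) + (\<Sum>e' | e' ;; f = g. \<partial> e (Step a e')))"
| "\<partial> (e\<^bsup>[p]\<^esup>) = (\<lambda>d.
    if pval p = 1 \<and> \<partial> e Tick = 1 then 0
    else case d of
      Tick \<Rightarrow> (1 - pval p) / (1 - pval p * \<partial> e Tick)
    | Step a (e' ;; h) \<Rightarrow>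
        if h = e\<^bsup>[p]\<^esup> then pval p * \<partial> e (Step a e') / (1 - pval p * \<partial> e Tick) else 0
    | Step a _ \<Rightarrow> 0)"

primrec E :: "'a pexp \<Rightarrow> real" where
  "E PZero = 0"
| "E POne = 1"
| "E (PAct a) = 0"
| "E (e \<oplus>\<^bsub>p\<^esub> f) = pval p * E e + (1 - pval p) * E f"
| "E (e ;; f) = E e * E f"
| "E (e\<^bsup>[p]\<^esup>) = (if E e = 1 \<and> pval p = 1 then 0 else (1 - pval p) / (1 - pval p * E e))"

inductive equiv0 :: "'a pexp \<Rightarrow> 'a pexp \<Rightarrow> bool"  (infix "\<equiv>\<^sub>0" 50) where
  refl: "e \<equiv>\<^sub>0 e"
| sym: "e \<equiv>\<^sub>0 f \<Longrightarrow> f \<equiv>\<^sub>0 e"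
| trans: "e \<equiv>\<^sub>0 f \<Longrightarrow> f \<equiv>\<^sub>0 g \<Longrightarrow> e \<equiv>\<^sub>0 g"
| cong_choice: "e \<equiv>\<^sub>0 e' \<Longrightarrow> f \<equiv>\<^sub>0 f' \<Longrightarrow> e \<oplus>\<^bsub>p\<^esub> f \<equiv>\<^sub>0 e' \<oplus>\<^bsub>p\<^esub> f'"
| cong_seq: "e \<equiv>\<^sub>0 e' \<Longrightarrow> f \<equiv>\<^sub>0 f' \<Longrightarrow> e ;; f \<equiv>\<^sub>0 e' ;; f'"
| cong_loop: "e \<equiv>\<^sub>0 e' \<Longrightarrow> e\<^bsup>[p]\<^esup> \<equiv>\<^sub>0 e'\<^bsup>[p]\<^esup>"
| C1: "e \<equiv>\<^sub>0 e \<oplus>\<^bsub>p\<^esub> e"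
| C2: "e \<equiv>\<^sub>0 e \<oplus>\<^bsub>prob_of 1\<^esub> f"
| C3: "e \<oplus>\<^bsub>p\<^esub> f \<equiv>\<^sub>0 f \<oplus>\<^bsub>prob_of (1 - pval p)\<^esub> e"
| C4: "1 - pval p * pval q \<noteq> 0 \<Longrightarrow>
    (e \<oplus>\<^bsub>p\<^esub> f) \<oplus>\<^bsub>q\<^esub> g \<equiv>\<^sub>0
    e \<oplus>\<^bsub>prob_of (pval p * pval q)\<^esub>
      (f \<oplus>\<^bsub>prob_of ((1 - pval p) * pval q / (1 - pval p * pval q))\<^esub> g)"
| D1: "(e \<oplus>\<^bsub>p\<^esub> f) ;; g \<equiv>\<^sub>0 (e ;; g) \<oplus>\<^bsub>p\<^esub> (f ;; g)"
| ZeroS: "PZero ;; e \<equiv>\<^sub>0 PZero"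
| OneS: "POne ;; e \<equiv>\<^sub>0 e"
| SOne: "e ;; POne \<equiv>\<^sub>0 e"
| S: "e ;; (f ;; g) \<equiv>\<^sub>0 (e ;; f) ;; g"
| Unroll: "(e ;; e\<^bsup>[p]\<^esup>) \<oplus>\<^bsub>p\<^esub> POne \<equiv>\<^sub>0 e\<^bsup>[p]\<^esup>"
| Tight: "1 - (1 - pval p) * pval q \<noteq> 0 \<Longrightarrow>
    (e \<oplus>\<^bsub>p\<^esub> POne)\<^bsup>[q]\<^esup> ;; POne \<equiv>\<^sub>0
    e\<^bsup>[prob_of (pval p * pval q / (1 - (1 - pval p) * pval q))]\<^esup>"
| Div: "POne\<^bsup>[prob_of 1]\<^esup> \<equiv>\<^sub>0 PZero"
| Unique: "g \<equiv>\<^sub>0 (e ;; g) \<oplus>\<^bsub>p\<^esub> f \<Longrightarrow> E e = 0 \<Longrightarrow> g \<equiv>\<^sub>0 e\<^bsup>[p]\<^esup> ;; f"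

text \<open>
  The n-ary choice is meant for finite \<open>I\<close> and weights \<open>p i \<ge> 0\<close>, \<open>i \<in> I\<close>, with sum at most 1;
  the value for infinite \<open>I\<close> is irrelevant. Under these conditions at most one index has
  weight 1, and the weights in the recursive call satisfy the same conditions
  (\<open>nchoice_weights\<close>). The index that is split off is an unspecified element of \<open>I\<close>.
\<close>

function nchoice :: "'i set \<Rightarrow> ('i \<Rightarrow> real) \<Rightarrow> ('i \<Rightarrow> 'a pexp) \<Rightarrow> 'a pexp" where
  "nchoice I p e =
    (if infinite I \<or> I = {} then PZero
     else if \<exists>k\<in>I. p k = 1 then e (SOME k. k \<in> I \<and> p k = 1)
     else let k = (SOME k. k \<in> I)
          in e k \<oplus>\<^bsub>prob_of (p k)\<^esub> nchoice (I - {k}) (\<lambda>i. p i / (1 - p k)) e)"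
  by pat_completeness auto
termination
proof (relation "measure (\<lambda>(I, _, _). card I)")
  fix I :: "'a set" and p :: "'a \<Rightarrow> real" and e :: "'a \<Rightarrow> 'b pexp" and k
  assume "\<not> (infinite I \<or> I = {})" and "k = (SOME k. k \<in> I)"
  then have "finite I" "k \<in> I" by (auto simp: some_in_eq)
  then show "((I - {k}, \<lambda>i. p i / (1 - p k), e), (I, p, e)) \<in> measure (\<lambda>(I, _, _). card I)"
    using card_Diff1_less[of I k] by (simp only: in_measure case_prod_conv)
qed simp

declare nchoice.simps [simp del]

primrec ex :: "('a, 'a pexp) F \<Rightarrow> 'a pexp" where
  "ex Tick = POne"
| "ex (Step a e') = PAct a ;; e'"


lemma C4_range:
  assumes "1 - pval p * pval q \<noteq> 0"
  shows "0 \<le> pval p * pval q" "pval p * pval q \<le> 1"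
    "0 \<le> (1 - pval p) * pval q / (1 - pval p * pval q)"
    "(1 - pval p) * pval q / (1 - pval p * pval q) \<le> 1"
proof -
  have l: "pval p * pval q \<le> 1" by (simp add: mult_le_one)
  then have "0 < 1 - pval p * pval q" using assms by linarith
  moreover have "(1 - pval p) * pval q \<le> 1 - pval p * pval q"
    using pval_le_1[of q] by (simp add: algebra_simps)
  ultimately show "0 \<le> (1 - pval p) * pval q / (1 - pval p * pval q)"
    "(1 - pval p) * pval q / (1 - pval p * pval q) \<le> 1"
    by (simp_all add: divide_le_eq)
  show "0 \<le> pval p * pval q" "pval p * pval q \<le> 1" using l by simp_all
qed

lemma Tight_range:
  assumes "1 - (1 - pval p) * pval q \<noteq> 0"
  shows "0 \<le> pval p * pval q / (1 - (1 - pval p) * pval q)"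
    "pval p * pval q / (1 - (1 - pval p) * pval q) \<le> 1"
proof -
  have "(1 - pval p) * pval q \<le> 1" by (simp add: mult_le_one)
  then have "0 < 1 - (1 - pval p) * pval q" using assms by linarith
  moreover have "pval p * pval q \<le> 1 - (1 - pval p) * pval q"
    using pval_le_1[of q] by (simp add: algebra_simps)
  ultimately show "0 \<le> pval p * pval q / (1 - (1 - pval p) * pval q)"
    "pval p * pval q / (1 - (1 - pval p) * pval q) \<le> 1"
    by (simp_all add: divide_le_eq)
qed

lemma nchoice_weights:
  fixes p :: "'i \<Rightarrow> real"
  assumes "finite I" "\<And>i. i \<in> I \<Longrightarrow> 0 \<le> p i" "sum p I \<le> 1" "k \<in> I" "p k \<noteq> 1"
  shows "p k \<le> 1" "\<And>i. i \<in> I - {k} \<Longrightarrow> 0 \<le> p i / (1 - p k)"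
    "(\<Sum>i\<in>I - {k}. p i / (1 - p k)) \<le> 1"
proof -
  have s: "sum p I = p k + sum p (I - {k})"
    using assms(1,4) by (rule sum.remove)
  moreover have n: "0 \<le> sum p (I - {k})" using assms(2) by (intro sum_nonneg) auto
  ultimately show "p k \<le> 1" using assms(3) by linarith
  then have l: "p k < 1" using assms(5) by linarith
  then show "0 \<le> p i / (1 - p k)" if "i \<in> I - {k}" for i using assms(2) that by simp
  have "(\<Sum>i\<in>I - {k}. p i / (1 - p k)) = sum p (I - {k}) / (1 - p k)"
    by (simp add: sum_divide_distrib)
  also have "\<dots> \<le> 1" using l s assms(3) by (simp add: divide_le_eq)
  finally show "(\<Sum>i\<in>I - {k}. p i / (1 - p k)) \<le> 1" .
qed

definition mass_le :: "('x \<Rightarrow> real) \<Rightarrow> real \<Rightarrow> bool" where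
  "mass_le \<nu> c \<longleftrightarrow> (\<forall>x. 0 \<le> \<nu> x) \<and> finite (supp \<nu>) \<and> sum \<nu> (supp \<nu>) \<le> c"

lemma mass_leI:
  assumes "\<And>x. 0 \<le> \<nu> x" "finite D" "\<And>x. x \<notin> D \<Longrightarrow> \<nu> x = 0" "sum \<nu> D \<le> c"
  shows "mass_le \<nu> c"
proof -
  have sub: "supp \<nu> \<subseteq> D" using assms(3) by (force simp: supp_def)
  then have "sum \<nu> (supp \<nu>) \<le> sum \<nu> D" using assms by (intro sum_mono2) auto
  with sub assms show ?thesis by (auto simp: mass_le_def intro: finite_subset)
qed

lemma mass_leD:
  assumes "mass_le \<nu> c" "finite D" 
  shows "sum \<nu> D \<le> c"
proof -
  have "sum \<nu> D = sum \<nu> (D \<inter> supp \<nu>)"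
    using assms by (intro sum.mono_neutral_right)
      (auto simp: supp_def mass_le_def order_less_le)
  also have "\<dots> \<le> sum \<nu> (supp \<nu>)"
    using assms by (intro sum_mono2) (auto simp: mass_le_def)
  finally show ?thesis using assms by (auto simp: mass_le_def)
qed

lemma mass_le_notin: "mass_le \<nu> c \<Longrightarrow> x \<notin> supp \<nu> \<Longrightarrow> \<nu> x = 0"
  by (metis mass_le_def supp_def mem_Collect_eq order_less_le)

lemma mass_le_comb:
  assumes "mass_le \<nu> c" "mass_le \<mu> d" "0 \<le> s" "0 \<le> t" "s * c + t * d \<le> b"
  shows "mass_le (\<lambda>x. s * \<nu> x + t * \<mu> x) b"
proof (rule mass_leI[where D = "supp \<nu> \<union> supp \<mu>"])
  let ?D = "supp \<nu> \<union> supp \<mu>"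
  show fin: "finite ?D" using assms by (simp add: mass_le_def)
  show "0 \<le> s * \<nu> x + t * \<mu> x" for x using assms by (simp add: mass_le_def)
  show "s * \<nu> x + t * \<mu> x = 0" if "x \<notin> ?D" for x
    using that mass_le_notin[OF assms(1)] mass_le_notin[OF assms(2)] by simp
  have "(\<Sum>x\<in>?D. s * \<nu> x + t * \<mu> x) = s * sum \<nu> ?D + t * sum \<mu> ?D"
    by (simp add: sum.distrib sum_distrib_left)
  also have "\<dots> \<le> s * c + t * d"
    using mass_leD[OF assms(1) fin] mass_leD[OF assms(2) fin] assms(3,4)
    by (intro add_mono mult_left_mono)
  finally show "(\<Sum>x\<in>?D. s * \<nu> x + t * \<mu> x) \<le> b" using assms by linarith
qed

lemma mass_le_dirac: "mass_le (dirac x) 1"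
  by (rule mass_leI[where D = "{x}"]) (auto simp: dirac_def)

definition steps :: "('a, 'a pexp) F \<Rightarrow> 'a pexp \<Rightarrow> (('a, 'a pexp) F \<Rightarrow> real) \<Rightarrow> real" where
  "steps d f \<nu> = (case d of Step a (e' ;; h) \<Rightarrow> if h = f then \<nu> (Step a e') else 0 | _ \<Rightarrow> 0)"

lemma mass_le_steps:
  assumes "mass_le \<nu> c"
  shows "mass_le (\<lambda>d. steps d f \<nu>) (c - \<nu> Tick)"
proof -
  let ?h = "\<lambda>d. case d of Tick \<Rightarrow> Tick | Step a e \<Rightarrow> Step a (e ;; f)"
  let ?S = "supp \<nu> - {Tick}"
  have fin: "finite ?S" using assms by (simp add: mass_le_def)
  have inj: "inj ?h" by (auto simp: inj_def split: F.splits)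
  show ?thesis
  proof (rule mass_leI[where D = "?h ` ?S"])
    show "0 \<le> steps d f \<nu>" for d
      using assms by (auto simp: steps_def mass_le_def split: F.splits pexp.splits)
    show "finite (?h ` ?S)" using fin by simp
    show "steps d f \<nu> = 0" if d: "d \<notin> ?h ` ?S" for d
    proof (rule ccontr)
      assume n: "steps d f \<nu> \<noteq> 0"
      then obtain a e' where "d = Step a (e' ;; f)" "\<nu> (Step a e') \<noteq> 0"
        by (auto simp: steps_def split: F.splits pexp.splits if_splits)
      then have "Step a e' \<in> ?S" "d = ?h (Step a e')" using mass_le_notin[OF assms] by auto
      with d show False by blast
    qed
    have "(\<Sum>d\<in>?h ` ?S. steps d f \<nu>) = (\<Sum>d\<in>?S. steps (?h d) f \<nu>)"
      by (subst sum.reindex) (auto intro: inj_on_subset[OF inj])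
    also have "\<dots> = sum \<nu> ?S" by (rule sum.cong) (auto simp: steps_def split: F.splits)
    also have "\<dots> \<le> c - \<nu> Tick"
      using mass_leD[OF assms, of "insert Tick ?S"] sum.insert[OF fin, of Tick \<nu>] fin by auto
    finally show "(\<Sum>d\<in>?h ` ?S. steps d f \<nu>) \<le> c - \<nu> Tick" .
  qed
qed

lemma deriv_seq: "\<partial> (e ;; f) d = \<partial> e Tick * \<partial> f d + 1 * steps d f (\<partial> e)"
proof (cases d)
  case (Step a g)
  have "(\<Sum>e' | e' ;; f = g. \<partial> e (Step a e')) = steps d f (\<partial> e)"
  proof (cases "\<exists>e'. e' ;; f = g")
    case True
    then obtain e' where g: "g = e' ;; f" by auto
    then have "{x. x ;; f = g} = {e'}" by auto
    then show ?thesis using Step g by (simp add: steps_def)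
  next
    case False
    then have "{x. x ;; f = g} = {}" by auto
    then show ?thesis using Step False by (auto simp: steps_def split: pexp.splits)
  qed
  then show ?thesis using Step by simp
qed (simp add: steps_def)

lemma deriv_loop:
  assumes "\<not> (pval p = 1 \<and> \<partial> e Tick = 1)"
  shows "\<partial> (e\<^bsup>[p]\<^esup>) d = (1 - pval p) / (1 - pval p * \<partial> e Tick) * dirac Tick d
    + pval p / (1 - pval p * \<partial> e Tick) * steps d (e\<^bsup>[p]\<^esup>) (\<partial> e)"
  using assms by (cases d) (auto simp: steps_def dirac_def split: pexp.splits)

lemma mass_le_deriv: "mass_le (\<partial> e) 1"
proof (induction e)
  case PZero
  show ?case by (rule mass_leI[where D = "{}"]) auto
next
  case (PChoice e p f)
  have "mass_le (\<lambda>d. pval p * \<partial> e d + (1 - pval p) * \<partial> f d) 1"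
    by (rule mass_le_comb[OF PChoice]) auto
  then show ?case by simp
next
  case (PSeq e f)
  have "0 \<le> \<partial> e Tick" using PSeq by (simp add: mass_le_def)
  then have "mass_le (\<lambda>d. \<partial> e Tick * \<partial> f d + 1 * steps d f (\<partial> e)) 1"
    by (intro mass_le_comb[OF PSeq(2) mass_le_steps[OF PSeq(1)]]) auto
  moreover have "\<partial> (e ;; f) = (\<lambda>d. \<partial> e Tick * \<partial> f d + 1 * steps d f (\<partial> e))"
    by (rule ext) (rule deriv_seq)
  ultimately show ?case by (simp only:)
next
  case (PLoop e p)
  show ?case
  proof (cases "pval p = 1 \<and> \<partial> e Tick = 1")
    case True
    then have "\<partial> (e\<^bsup>[p]\<^esup>) = (\<lambda>_. 0)" by (intro ext) simp
    then show ?thesis by (simp only:) (rule mass_leI[where D = "{}"], auto)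
  next
    case False
    let ?s = "\<partial> e Tick"
    have s: "0 \<le> ?s" "?s \<le> 1"
      using PLoop mass_leD[OF PLoop, of "{Tick}"] by (auto simp: mass_le_def)
    have "pval p * ?s \<noteq> 1"
    proof
      assume 1: "pval p * ?s = 1"
      have "pval p * ?s \<le> pval p" "pval p * ?s \<le> ?s"
        using s by (auto intro: mult_left_le mult_left_le_one_le)
      then show False using 1 False s pval_le_1[of p] by linarith
    qed
    moreover have "pval p * ?s \<le> 1" using s by (simp add: mult_le_one)
    ultimately have pos: "0 < 1 - pval p * ?s" by linarith
    have "(1 - pval p) / (1 - pval p * ?s) * 1 + pval p / (1 - pval p * ?s) * (1 - ?s) = 1"
      using pos by (simp add: field_simps)
    then have "mass_le (\<lambda>d. (1 - pval p) / (1 - pval p * ?s) * dirac Tick d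
        + pval p / (1 - pval p * ?s) * steps d (e\<^bsup>[p]\<^esup>) (\<partial> e)) 1"
      using pos by (intro mass_le_comb[OF mass_le_dirac mass_le_steps[OF PLoop]]) auto
    moreover have "\<partial> (e\<^bsup>[p]\<^esup>) = (\<lambda>d. (1 - pval p) / (1 - pval p * ?s) * dirac Tick d
        + pval p / (1 - pval p * ?s) * steps d (e\<^bsup>[p]\<^esup>) (\<partial> e))"
      by (rule ext) (rule deriv_loop[OF False])
    ultimately show ?thesis by (simp only:)
  qed
qed (simp_all add: mass_le_dirac)

theorem subdist_deriv: "subdist (\<partial> e)"
  using mass_le_deriv[of e] by (simp add: subdist_def mass_le_def)

end

theory Submission
  imports Defs
begin

text \<open>
  Axioms C1 to C4 make expressions modulo \<open>\<equiv>\<^sub>0\<close> a convex algebra, and every convex algebra embeds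
  into a cone: pairs of a nonnegative weight and an element, those of weight 0 identified, with
  \<open>(r, x) + (s, y) = (r + s, x \<oplus>\<^bsub>r/(r+s)\<^esub> y)\<close>, form a commutative monoid, in which
  \<open>(1, x \<oplus>\<^bsub>p\<^esub> y) = (p, x) + (1 - p, y)\<close> and the \<open>n\<close>-ary choice is an ordinary finite sum,
  completed to total weight 1 by a multiple of \<open>PZero\<close>.
  Right multiplication by an expression is additive by D1, so the claim follows by induction
  on the expression. For a loop over \<open>e\<close> with \<open>s = \<partial> e Tick\<close>, the induction hypothesis splits
  \<open>e\<close> as \<open>g \<oplus>\<^bsub>1-s\<^esub> POne\<close>, Tight turns the loop into a loop over \<open>g\<close>, and one Unroll exposes the
  derivative.
\<close>

section \<open>The cone of weighted expressions\<close>

declare equiv0.refl [simp]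

lemma pval_prob_of_0 [simp]: "pval (prob_of 0) = 0"
  and pval_prob_of_1 [simp]: "pval (prob_of 1) = 1"
  by (simp_all add: pval_prob_of)

lemma choice_0: "x \<oplus>\<^bsub>prob_of 0\<^esub> y \<equiv>\<^sub>0 y"
  using C3[of x "prob_of 0" y] C2[of y x] by (auto intro: equiv0.trans equiv0.sym)

lemma choice_1: "x \<oplus>\<^bsub>prob_of 1\<^esub> y \<equiv>\<^sub>0 x"
  by (rule equiv0.sym[OF C2])

text \<open>A pair with negative weight is not related even to itself, which makes the quotient
  partial and confines it to nonnegative weights.\<close>

fun cone_rel :: "real \<times> 'a pexp \<Rightarrow> real \<times> 'a pexp \<Rightarrow> bool" where
  "cone_rel (r, x) (s, y) \<longleftrightarrow> r = s \<and> 0 \<le> r \<and> (r = 0 \<or> x \<equiv>\<^sub>0 y)"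

quotient_type 'a cone = "real \<times> 'a pexp" / partial: cone_rel
proof (rule part_equivpI)
  show "\<exists>x. cone_rel x x" by (rule exI[of _ "(0, PZero)"]) simp
  show "symp cone_rel" by (auto intro!: sympI intro: equiv0.sym)
  show "transp cone_rel" by (auto intro!: transpI intro: equiv0.trans)
qed

text \<open>Only nonnegative arguments matter; \<open>max 0\<close> here and the absolute value in \<open>scale\<close> are
  for totality.\<close>

lift_definition wt :: "real \<Rightarrow> 'a pexp \<Rightarrow> 'a cone" is "\<lambda>r x. (max 0 r, x)"
  by simp

lift_definition mass :: "'a cone \<Rightarrow> real" is fst
  by auto

lift_definition scale :: "real \<Rightarrow> 'a cone \<Rightarrow> 'a cone" is "\<lambda>t (r, x). (\<bar>t\<bar> * r, x)"
  by auto

lift_definition cseq :: "'a cone \<Rightarrow> 'a pexp \<Rightarrow> 'a cone" is "\<lambda>(r, x) f. (r, x ;; f)"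
  by (auto simp: cong_seq)

text \<open>Makes addition on the cone well defined: a summand of weight 0 carries an arbitrary
  expression, and a choice with probability 0 or 1 discards it.\<close>

lemma choice_weighted_cong:
  assumes "r = 0 \<or> x \<equiv>\<^sub>0 x'" "s = 0 \<or> y \<equiv>\<^sub>0 y'" "r + s \<noteq> 0"
  shows "x \<oplus>\<^bsub>prob_of (r / (r + s))\<^esub> y \<equiv>\<^sub>0 x' \<oplus>\<^bsub>prob_of (r / (r + s))\<^esub> y'"
proof -
  consider "r = 0" "y \<equiv>\<^sub>0 y'" | "s = 0" "x \<equiv>\<^sub>0 x'" "r \<noteq> 0" | "x \<equiv>\<^sub>0 x'" "y \<equiv>\<^sub>0 y'"
    using assms by auto
  then show ?thesis
  proof cases
    case 1
    then show ?thesis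
      using choice_0 by (metis div_0 equiv0.sym equiv0.trans)
  next
    case 2
    then show ?thesis
      using choice_1 by (metis add.right_neutral divide_self equiv0.sym equiv0.trans)
  qed (rule cong_choice)
qed

instantiation cone :: (type) "{zero, plus}"
begin

lift_definition zero_cone :: "'a cone" is "(0, PZero)"
  by simp

lift_definition plus_cone :: "'a cone \<Rightarrow> 'a cone \<Rightarrow> 'a cone"
  \<comment> \<open>If \<open>r + s = 0\<close>, the division defaults to 0; the result then has
    weight 0, so its expression is irrelevant.\<close>
  is "\<lambda>(r, x) (s, y). (r + s, x \<oplus>\<^bsub>prob_of (r / (r + s))\<^esub> y)"
  subgoal for u u' v v'
    using choice_weighted_cong[of "fst u" "snd u" "snd u'" "fst v" "snd v" "snd v'"]
    by (cases u; cases u'; cases v; cases v') auto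
  done

instance ..

end

section \<open>Generators and commutative monoid laws of the cone\<close>

lemma cone_cases:
  obtains r x where "0 \<le> r" "c = wt r x"
proof -
  have "\<exists>r x. 0 \<le> r \<and> c = wt r x"
  proof transfer
    show "\<exists>r x. 0 \<le> r \<and> cone_rel c (max 0 r, x)" if "cone_rel c c" for c :: "real \<times> 'a pexp"
      using that by (intro exI[of _ "fst c"] exI[of _ "snd c"]) (cases c, auto)
  qed
  with that show thesis by blast
qed

text \<open>The bridge back to expressions: at weight 1, equality in the cone is
  \<open>\<equiv>\<^sub>0\<close>.\<close>

lemma wt_eq_iff: "0 \<le> r \<Longrightarrow> wt r x = wt r y \<longleftrightarrow> r = 0 \<or> x \<equiv>\<^sub>0 y"
  by transfer auto

lemma wt_0 [simp]: "wt 0 x = 0"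
  by transfer simp

lemma mass_wt [simp]: "0 \<le> r \<Longrightarrow> mass (wt r x) = r"
  by transfer simp

lemma scale_wt [simp]: "0 \<le> t \<Longrightarrow> 0 \<le> r \<Longrightarrow> scale t (wt r x) = wt (t * r) x"
  by transfer simp

lemma cseq_wt [simp]: "cseq (wt r x) f = wt r (x ;; f)"
  by transfer simp

lemma wt_plus_wt:
  "0 \<le> r \<Longrightarrow> 0 \<le> s \<Longrightarrow> wt r x + wt s y = wt (r + s) (x \<oplus>\<^bsub>prob_of (r / (r + s))\<^esub> y)"
  by transfer simp

lemma cone_zero_plus: "0 + c = (c :: 'a cone)"
  by transfer (auto intro: choice_0)

lemma cone_plus_commute: "b + c = c + (b :: 'a cone)"
proof -
  obtain r x where b: "0 \<le> r" "b = wt r x" by (rule cone_cases)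
  obtain s y where c: "0 \<le> s" "c = wt s y" by (rule cone_cases)
  show ?thesis
  proof (cases "r + s = 0")
    case False
    then have "pval (prob_of (r / (r + s))) = r / (r + s)"
      using b c by (intro pval_prob_of) (auto simp: divide_le_eq)
    moreover have "1 - r / (r + s) = s / (s + r)" using False by (simp add: field_simps)
    ultimately have "x \<oplus>\<^bsub>prob_of (r / (r + s))\<^esub> y \<equiv>\<^sub>0 y \<oplus>\<^bsub>prob_of (s / (s + r))\<^esub> x"
      using C3[of x "prob_of (r / (r + s))" y] by simp
    with b c show ?thesis by (simp add: wt_plus_wt wt_eq_iff add.commute)
  qed (use b c in \<open>simp add: add_nonneg_eq_0_iff\<close>)
qed

text \<open>This is C4: both bracketings give \<open>x\<close>, \<open>y\<close>, \<open>z\<close>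
  the shares \<open>r\<close>, \<open>s\<close>, \<open>t\<close> of the total
  \<open>r + s + t\<close>. Positivity keeps the denominators nonzero; zero weights are left to the
  monoid instance.\<close>

lemma wt_plus_assoc:
  assumes "0 < r" "0 < s" "0 < t"
  shows "(wt r x + wt s y) + wt t z = wt r x + (wt s y + wt t z)"
proof -
  let ?p = "prob_of (r / (r + s))" and ?q = "prob_of ((r + s) / (r + s + t))"
  have p: "pval ?p = r / (r + s)" and q: "pval ?q = (r + s) / (r + s + t)"
    using assms by (auto intro!: pval_prob_of simp: divide_le_eq)
  have pq: "pval ?p * pval ?q = r / (r + (s + t))"
    unfolding p q using assms by (simp add: add.assoc)
  have n: "1 - r / (r + (s + t)) = (s + t) / (r + (s + t))"
    using assms by (simp add: field_simps)
  have "1 - r / (r + s) = s / (r + s)" using assms by (simp add: field_simps)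
  then have "(1 - pval ?p) * pval ?q = s / (r + (s + t))"
    unfolding p q using assms by (simp add: add.assoc)
  then have "(1 - pval ?p) * pval ?q / (1 - pval ?p * pval ?q) = s / (s + t)"
    unfolding pq n using assms by simp
  moreover have "1 - pval ?p * pval ?q \<noteq> 0" unfolding pq n using assms by simp
  ultimately have "(x \<oplus>\<^bsub>?p\<^esub> y) \<oplus>\<^bsub>?q\<^esub> z \<equiv>\<^sub>0
      x \<oplus>\<^bsub>prob_of (r / (r + (s + t)))\<^esub> (y \<oplus>\<^bsub>prob_of (s / (s + t))\<^esub> z)"
    using C4[of ?p ?q x y z] pq by simp
  with assms show ?thesis by (simp add: wt_plus_wt wt_eq_iff add.assoc)
qed

instance cone :: (type) comm_monoid_add
proof
  fix a b c :: "'a cone"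
  show "0 + a = a" by (rule cone_zero_plus)
  show "a + b = b + a" by (rule cone_plus_commute)
  obtain r x where a: "0 \<le> r" "a = wt r x" by (rule cone_cases)
  obtain s y where b: "0 \<le> s" "b = wt s y" by (rule cone_cases)
  obtain t z where c: "0 \<le> t" "c = wt t z" by (rule cone_cases)
  consider "r = 0" | "s = 0" | "t = 0" | "0 < r" "0 < s" "0 < t" using a b c by linarith
  then show "a + b + c = a + (b + c)"
    by cases (simp_all add: a b c wt_plus_assoc cone_zero_plus cone_plus_commute[of _ 0])
qed

lemma mass_plus [simp]: "mass (b + c) = mass b + mass c"
  by transfer auto

lemma mass_zero [simp]: "mass 0 = 0"
  by transfer simp

lemma scale_plus: "scale t (b + c) = scale t b + scale t c"
  by transfer (auto simp: distrib_left[symmetric])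

lemma cseq_plus: "cseq (b + c) f = cseq b f + cseq c f"
  by transfer (auto intro: D1)

lemma scale_zero [simp]: "scale t 0 = 0"
  by transfer simp

text \<open>Splitting a weight is idempotence of choice, C1.\<close>

lemma wt_add:
  assumes "0 \<le> r" "0 \<le> s"
  shows "wt (r + s) x = wt r x + wt s x"
  using assms by (simp add: wt_plus_wt wt_eq_iff C1)

lemma wt_choice: "wt 1 (x \<oplus>\<^bsub>p\<^esub> y) = wt (pval p) x + wt (1 - pval p) y"
  by (simp add: wt_plus_wt prob_of_pval)

lemma wt_seq_POne: "wt r (POne ;; f) = wt r f"
  by transfer (simp add: OneS)

lemma wt_seq_PZero: "wt r (PZero ;; f) = wt r PZero"
  by transfer (simp add: ZeroS)

lemma wt_seq_assoc: "wt r ((e ;; f) ;; g) = wt r (e ;; (f ;; g))"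
  by transfer (simp add: equiv0.sym[OF S])

section \<open>Representation of cone elements by weights, and of expressions by their
  derivatives\<close>

text \<open>\<open>rep c \<nu>\<close>: the cone element \<open>c\<close> is the combination of the \<open>ex d\<close> with weights \<open>\<nu> d\<close>,
  plus some multiple of \<open>PZero\<close>.\<close>

inductive rep :: "'a cone \<Rightarrow> (('a, 'a pexp) F \<Rightarrow> real) \<Rightarrow> bool" where
  zero: "0 \<le> r \<Longrightarrow> rep (wt r PZero) (\<lambda>_. 0)"
| atom: "0 \<le> r \<Longrightarrow> rep (wt r (ex d)) (\<lambda>d'. r * dirac d d')"
| add: "rep b \<nu> \<Longrightarrow> rep c \<mu> \<Longrightarrow> rep (b + c) (\<lambda>d. \<nu> d + \<mu> d)"

lemma rep_scale: "rep c \<nu> \<Longrightarrow> 0 \<le> t \<Longrightarrow> rep (scale t c) (\<lambda>d. t * \<nu> d)"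
proof (induction rule: rep.induct)
  case (zero r)
  then show ?case using rep.zero[of "t * r"] by simp
next
  case (atom r d)
  then show ?case using rep.atom[of "t * r" d] by (simp add: mult.assoc)
next
  case (add b \<nu> c \<mu>)
  then show ?case using rep.add[of "scale t b" _ "scale t c"] by (simp add: scale_plus distrib_left)
qed

lemma rep_nonneg: "rep c \<nu> \<Longrightarrow> 0 \<le> \<nu> d"
  by (induction rule: rep.induct) (auto simp: dirac_def)

lemma rep_scale_wt:
  assumes "rep (wt 1 e) \<nu>" "0 \<le> t"
  shows "rep (wt t e) (\<lambda>d. t * \<nu> d)"
  using rep_scale[OF assms] assms by simp

text \<open>Separates immediate termination from the rest \<open>b\<close>. Multiplied by
  \<open>f\<close> on the right, an atom \<open>PAct a ;; e\<close> of \<open>b\<close> reassociates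
  to \<open>PAct a ;; (e ;; f)\<close>, again an atom, and \<open>PZero\<close> absorbs
  \<open>f\<close>. Sequencing and loops both rest on this.\<close>

lemma rep_split_Tick:
  assumes "rep c \<nu>"
  obtains b where "c = b + wt (\<nu> Tick) POne" "\<And>f. rep (cseq b f) (\<lambda>d. steps d f \<nu>)"
proof -
  have "\<exists>b. c = b + wt (\<nu> Tick) POne \<and> (\<forall>f. rep (cseq b f) (\<lambda>d. steps d f \<nu>))"
    using assms
  proof (induction rule: rep.induct)
    case (zero r)
    have "(\<lambda>d. steps d f (\<lambda>_. 0)) = (\<lambda>_. 0)" for f :: "'a pexp"
      by (auto simp: steps_def split: F.splits pexp.splits)
    with zero show ?case
      by (intro exI[of _ "wt r PZero"]) (auto simp: wt_seq_PZero intro: rep.zero)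
  next
    case (atom r d)
    show ?case
    proof (cases d)
      case Tick
      have "(\<lambda>d'. steps d' f (\<lambda>d'. r * dirac d d')) = (\<lambda>_. 0)" for f :: "'a pexp"
        using Tick by (auto simp: steps_def dirac_def split: F.splits pexp.splits)
      moreover have "rep (cseq 0 f) (\<lambda>_. 0)" for f :: "'a pexp"
        using rep.zero[of 0] cseq_wt[of 0 PZero f] by simp
      ultimately show ?thesis using Tick by (intro exI[of _ 0]) (auto simp: dirac_def)
    next
      case (Step a e)
      have "(\<lambda>d'. steps d' f (\<lambda>d'. r * dirac d d')) = (\<lambda>d'. r * dirac (Step a (e ;; f)) d')" for f
        using Step by (auto simp: steps_def dirac_def fun_eq_iff split: F.splits pexp.splits)
      then show ?thesis using Step rep.atom[OF atom, of "Step a (e ;; f)" for f]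
        by (intro exI[of _ "wt r (ex d)"]) (auto simp: dirac_def wt_seq_assoc)
    qed
  next
    case (add b \<nu> c \<mu>)
    then obtain b' c' where
      b: "b = b' + wt (\<nu> Tick) POne" "\<And>f. rep (cseq b' f) (\<lambda>d. steps d f \<nu>)" and
      c: "c = c' + wt (\<mu> Tick) POne" "\<And>f. rep (cseq c' f) (\<lambda>d. steps d f \<mu>)" by blast
    have "(\<lambda>d. steps d f (\<lambda>d. \<nu> d + \<mu> d)) = (\<lambda>d. steps d f \<nu> + steps d f \<mu>)" for f :: "'a pexp"
      by (auto simp: steps_def fun_eq_iff split: F.splits pexp.splits)
    moreover have "b + c = b' + c' + wt (\<nu> Tick + \<mu> Tick) POne"
      using add.hyps by (simp add: wt_add rep_nonneg b(1) c(1) ac_simps)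
    ultimately show ?case
      using rep.add[OF b(2) c(2)] by (intro exI[of _ "b' + c'"]) (auto simp: cseq_plus)
  qed
  with that show thesis by blast
qed

lemma rep_loop:
  assumes e: "rep (wt 1 e) (\<partial> e)"
  shows "rep (wt 1 (e\<^bsup>[p]\<^esup>)) (\<partial> (e\<^bsup>[p]\<^esup>))"
proof -
  define s where "s = \<partial> e Tick"
  obtain b where b: "wt 1 e = b + wt s POne" "\<And>f. rep (cseq b f) (\<lambda>d. steps d f (\<partial> e))"
    using rep_split_Tick[OF e] unfolding s_def by blast
  have s0: "0 \<le> s" using rep_nonneg[OF e] by (simp add: s_def)
  obtain m g where g: "0 \<le> m" "b = wt m g" by (rule cone_cases)
  \<comment> \<open>The multiple of \<open>PZero\<close> lies in \<open>b\<close>, so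
    \<open>b\<close> has weight \<open>1 - s\<close> even if the derivative has total mass below
    1.\<close>
  have m: "m = 1 - s" using arg_cong[OF b(1), of mass] g s0 by simp
  then have s1: "s \<le> 1" using g by simp
  have e_eq: "e \<equiv>\<^sub>0 g \<oplus>\<^bsub>prob_of (1 - s)\<^esub> POne"
    using b(1) s0 s1 by (simp add: g m wt_plus_wt wt_eq_iff)
  show ?thesis
  proof (cases "pval p = 1 \<and> s = 1")
    case True
    have "e \<equiv>\<^sub>0 POne" using e_eq choice_0 True by (auto intro: equiv0.trans)
    moreover have "p = prob_of 1" using True prob_of_pval[of p] by simp
    ultimately have "e\<^bsup>[p]\<^esup> \<equiv>\<^sub>0 PZero" using Div cong_loop equiv0.trans by blast
    then have "wt 1 (e\<^bsup>[p]\<^esup>) = wt 1 PZero" by (simp add: wt_eq_iff)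
    moreover have "\<partial> (e\<^bsup>[p]\<^esup>) = (\<lambda>_. 0)" using True by (auto simp: s_def)
    ultimately show ?thesis using rep.zero[of 1] by simp
  next
    case False
    have "s * pval p \<le> pval p" "s * pval p \<le> s"
      using s0 s1 by (auto intro: mult_left_le mult_left_le_one_le)
    then have pos: "0 < 1 - s * pval p" using False s1 pval_le_1[of p] by linarith
    let ?L = "e\<^bsup>[p]\<^esup>" and ?t = "pval p / (1 - s * pval p)"
    \<comment> \<open>The loop probability that Tight yields for \<open>g\<close> chosen with
      probability \<open>1 - s\<close>.\<close>
    define r where "r = (1 - s) * pval p / (1 - s * pval p)"
    have "(1 - s) * pval p \<le> 1 - s * pval p" using pval_le_1[of p] by (simp add: algebra_simps)
    then have r: "0 \<le> r" "r \<le> 1" using pos s1 by (auto simp: r_def divide_le_eq)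
    have q: "pval (prob_of (1 - s)) = 1 - s" using s0 s1 by (simp add: pval_prob_of)
    have tight: "(g \<oplus>\<^bsub>prob_of (1 - s)\<^esub> POne)\<^bsup>[p]\<^esup> ;; POne \<equiv>\<^sub>0 g\<^bsup>[prob_of r]\<^esup>"
      using Tight[of "prob_of (1 - s)" p g] pos by (simp add: q r_def)
    have L: "?L \<equiv>\<^sub>0 g\<^bsup>[prob_of r]\<^esup>"
      by (rule equiv0.trans[OF cong_loop[OF e_eq]
            equiv0.trans[OF equiv0.sym[OF SOne] tight]])
    \<comment> \<open>After unrolling, the inner loop over \<open>g\<close> is turned back into
      \<open>?L\<close>, since the derivative leads to states of the form
      \<open>e' ;; ?L\<close>.\<close>
    have "g ;; g\<^bsup>[prob_of r]\<^esup> \<oplus>\<^bsub>prob_of r\<^esub> POne \<equiv>\<^sub>0 g ;; ?L \<oplus>\<^bsub>prob_of r\<^esub> POne"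
      by (rule cong_choice[OF cong_seq[OF equiv0.refl equiv0.sym[OF L]] equiv0.refl])
    then have "?L \<equiv>\<^sub>0 g ;; ?L \<oplus>\<^bsub>prob_of r\<^esub> POne"
      by (meson L Unroll equiv0.sym equiv0.trans)
    then have "wt 1 ?L = wt 1 (g ;; ?L \<oplus>\<^bsub>prob_of r\<^esub> POne)"
      by (simp add: wt_eq_iff)
    \<comment> \<open>or rather\<close>
    also have "\<dots> = wt r (g ;; ?L) + wt (1 - r) POne"
      using r by (simp add: wt_choice pval_prob_of)
    also have "wt r (g ;; ?L) = scale ?t (cseq b ?L)"
      using pos g by (simp add: m r_def mult.commute)
    finally have "wt 1 ?L = scale ?t (cseq b ?L) + wt (1 - r) (ex Tick)" by simp
    moreover have "rep (scale ?t (cseq b ?L) + wt (1 - r) (ex Tick))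
        (\<lambda>d. ?t * steps d ?L (\<partial> e) + (1 - r) * dirac Tick d)"
      using r pos by (intro rep.add rep_scale b rep.atom) auto
    moreover have "1 - r = (1 - pval p) / (1 - pval p * s)"
      using pos by (simp add: r_def field_simps)
    then have "\<partial> ?L = (\<lambda>d. ?t * steps d ?L (\<partial> e) + (1 - r) * dirac Tick d)"
      using False by (intro ext, subst deriv_loop) (auto simp: s_def mult.commute)
    ultimately show ?thesis by simp
  qed
qed

lemma rep_deriv: "rep (wt 1 e) (\<partial> e)"
proof (induction e)
  case PZero
  then show ?case using rep.zero[of 1] by simp
next
  case POne
  then show ?case using rep.atom[of 1 Tick] by simp
next
  case (PAct a)
  have "wt 1 (PAct a) = wt 1 (ex (Step a POne))"
    using equiv0.sym[OF SOne] by (simp add: wt_eq_iff)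
  then show ?case using rep.atom[of 1 "Step a POne"] by simp
next
  case (PChoice e p f)
  then show ?case
    using rep.add[OF rep_scale_wt rep_scale_wt, of e "\<partial> e" "pval p" f "\<partial> f" "1 - pval p"]
    by (simp add: wt_choice)
next
  case (PSeq e f)
  obtain b where b: "wt 1 e = b + wt (\<partial> e Tick) POne" "rep (cseq b f) (\<lambda>d. steps d f (\<partial> e))"
    using rep_split_Tick[OF PSeq(1)] by blast
  have "wt 1 (e ;; f) = wt (\<partial> e Tick) f + cseq b f"
    using arg_cong[OF b(1), of "\<lambda>c. cseq c f"] by (simp add: cseq_plus wt_seq_POne add.commute)
  moreover have "\<partial> (e ;; f) = (\<lambda>d. \<partial> e Tick * \<partial> f d + steps d f (\<partial> e))"
    by (rule ext) (simp add: deriv_seq del: deriv.simps)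
  ultimately show ?case
    using rep.add[OF rep_scale_wt[OF PSeq(2)] b(2)] rep_nonneg[OF PSeq(1)] by simp
next
  case (PLoop e p)
  then show ?case by (rule rep_loop)
qed

lemma sum_wt_superset:
  assumes "finite D" "C \<subseteq> D" "\<And>d. d \<notin> C \<Longrightarrow> \<nu> d = 0"
  shows "(\<Sum>d\<in>C. wt (\<nu> d) (h d)) = (\<Sum>d\<in>D. wt (\<nu> d) (h d))"
  using assms by (intro sum.mono_neutral_left) auto

lemma mass_sum_wt: "(\<And>i. i \<in> I \<Longrightarrow> 0 \<le> p i) \<Longrightarrow> mass (\<Sum>i\<in>I. wt (p i) (h i)) = sum p I"
  by (induction I rule: infinite_finite_induct) auto

lemma scale_sum: "scale t (\<Sum>i\<in>I. h i) = (\<Sum>i\<in>I. scale t (h i))"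
  by (induction I rule: infinite_finite_induct) (auto simp: scale_plus)

lemma rep_sum:
  assumes "rep c \<nu>"
  obtains D z where "finite D" "\<And>d. d \<notin> D \<Longrightarrow> \<nu> d = 0" "0 \<le> z"
    "c = (\<Sum>d\<in>D. wt (\<nu> d) (ex d)) + wt z PZero"
proof -
  have "\<exists>D z. finite D \<and> (\<forall>d. d \<notin> D \<longrightarrow> \<nu> d = 0) \<and> 0 \<le> z \<and>
      c = (\<Sum>d\<in>D. wt (\<nu> d) (ex d)) + wt z PZero"
    using assms
  proof (induction rule: rep.induct)
    case (zero r)
    then show ?case by (intro exI[of _ "{}"] exI[of _ r]) auto
  next
    case (atom r d)
    then show ?case by (intro exI[of _ "{d}"] exI[of _ 0]) (auto simp: dirac_def)
  next
    case (add b \<nu> c \<mu>)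
    obtain B y where B: "finite B" "\<And>d. d \<notin> B \<Longrightarrow> \<nu> d = 0" "0 \<le> y"
      "b = (\<Sum>d\<in>B. wt (\<nu> d) (ex d)) + wt y PZero" using add by blast
    obtain C z where C: "finite C" "\<And>d. d \<notin> C \<Longrightarrow> \<mu> d = 0" "0 \<le> z"
      "c = (\<Sum>d\<in>C. wt (\<mu> d) (ex d)) + wt z PZero" using add by blast
    have "b + c = (\<Sum>d\<in>B \<union> C. wt (\<nu> d) (ex d)) + (\<Sum>d\<in>B \<union> C. wt (\<mu> d) (ex d))
        + wt (y + z) PZero"
      using B C sum_wt_superset[of "B \<union> C" B \<nu> ex] sum_wt_superset[of "B \<union> C" C \<mu> ex]
      by (simp add: wt_add ac_simps)
    also have "\<dots> = (\<Sum>d\<in>B \<union> C. wt (\<nu> d + \<mu> d) (ex d)) + wt (y + z) PZero"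
      using add.hyps by (simp add: wt_add rep_nonneg sum.distrib)
    finally show ?case using B C by (intro exI[of _ "B \<union> C"] exI[of _ "y + z"]) auto
  qed
  with that show thesis by blast
qed

lemma wt_nchoice:
  assumes "finite I" "\<And>i. i \<in> I \<Longrightarrow> 0 \<le> p i" "sum p I \<le> 1"
  shows "wt 1 (nchoice I p h) = (\<Sum>i\<in>I. wt (p i) (h i)) + wt (1 - sum p I) PZero"
  using assms
proof (induction "card I" arbitrary: I p)
  case 0
  then show ?case by (simp add: nchoice.simps)
next
  case (Suc n)
  then have ne: "I \<noteq> {}" by auto
  show ?case
  proof (cases "\<exists>k\<in>I. p k = 1")
    case True
    define k where "k = (SOME k. k \<in> I \<and> p k = 1)"
    have k: "k \<in> I" "p k = 1" using True someI_ex[of "\<lambda>k. k \<in> I \<and> p k = 1"] by (auto simp: k_def)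
    have rest: "sum p (I - {k}) = 0"
      using Suc.prems k sum.remove[of I k p] sum_nonneg[of "I - {k}" p] by auto
    then have "p i = 0" if "i \<in> I - {k}" for i
      using sum_nonneg_eq_0_iff[of "I - {k}" p] Suc.prems that by auto
    then have "(\<Sum>i\<in>I - {k}. wt (p i) (h i)) = 0" by (intro sum.neutral) simp
    moreover have "nchoice I p h = h k"
      using True ne Suc.prems by (simp add: nchoice.simps k_def)
    ultimately show ?thesis
      using Suc.prems k rest sum.remove[of I k p] sum.remove[of I k "\<lambda>i. wt (p i) (h i)"] by simp
  next
    case False
    define k where "k = (SOME k. k \<in> I)"
    have k: "k \<in> I" using ne by (simp add: k_def some_in_eq)
    let ?p = "\<lambda>i. p i / (1 - p k)"
    have w: "p k \<le> 1" "\<And>i. i \<in> I - {k} \<Longrightarrow> 0 \<le> ?p i" "sum ?p (I - {k}) \<le> 1"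
      using nchoice_weights[of I p k] Suc.prems k False by auto
    have pk: "0 \<le> p k" "p k < 1" using w(1) k False Suc.prems by (auto simp: order_less_le)
    have "wt 1 (nchoice I p h) = wt 1 (h k \<oplus>\<^bsub>prob_of (p k)\<^esub> nchoice (I - {k}) ?p h)"
      using False ne Suc.prems by (subst nchoice.simps) (simp add: k_def Let_def)
    also have "\<dots> = wt (p k) (h k) + scale (1 - p k) (wt 1 (nchoice (I - {k}) ?p h))"
      using pk by (simp add: wt_choice pval_prob_of)
    also have "wt 1 (nchoice (I - {k}) ?p h)
        = (\<Sum>i\<in>I - {k}. wt (?p i) (h i)) + wt (1 - sum ?p (I - {k})) PZero"
      using Suc.hyps(2) Suc.prems(1) k w by (intro Suc.hyps(1)) auto
    also have "scale (1 - p k) \<dots> = (\<Sum>i\<in>I - {k}. wt (p i) (h i))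
        + wt ((1 - p k) * (1 - sum ?p (I - {k}))) PZero"
    proof -
      have "(\<Sum>i\<in>I - {k}. scale (1 - p k) (wt (?p i) (h i))) = (\<Sum>i\<in>I - {k}. wt (p i) (h i))"
        using pk w(2) by (intro sum.cong) auto
      then show ?thesis using pk w(3) by (simp add: scale_plus scale_sum)
    qed
    also have "(1 - p k) * (1 - sum ?p (I - {k})) = 1 - sum p I"
      using pk sum.remove[OF Suc.prems(1) k, of p]
      by (simp add: sum_divide_distrib[symmetric] field_simps)
    finally show ?thesis
      using sum.remove[OF Suc.prems(1) k, of "\<lambda>i. wt (p i) (h i)"] by (simp add: add.assoc)
  qed
qed

theorem theorem6p2:
  fixes e :: "'a::finite pexp"
  shows "e \<equiv>\<^sub>0 nchoice (supp (\<partial> e)) (\<partial> e) ex"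
proof -
  have sd: "finite (supp (\<partial> e))" "\<And>d. 0 \<le> \<partial> e d" "sum (\<partial> e) (supp (\<partial> e)) \<le> 1"
    using subdist_deriv[of e] by (auto simp: subdist_def)
  obtain D z where D: "finite D" "\<And>d. d \<notin> D \<Longrightarrow> \<partial> e d = 0" "0 \<le> z"
    "wt 1 e = (\<Sum>d\<in>D. wt (\<partial> e d) (ex d)) + wt z PZero"
    using rep_sum[OF rep_deriv] by blast
  have "supp (\<partial> e) \<subseteq> D" using D(2) by (force simp: supp_def)
  moreover have "\<partial> e d = 0" if "d \<notin> supp (\<partial> e)" for d
    using that sd(2)[of d] by (simp add: supp_def)
  ultimately have *: "wt 1 e = (\<Sum>d\<in>supp (\<partial> e). wt (\<partial> e d) (ex d)) + wt z PZero"
    using D sum_wt_superset[of D "supp (\<partial> e)" "\<partial> e" ex] by simp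
  moreover have "z = 1 - sum (\<partial> e) (supp (\<partial> e))"
    using arg_cong[OF *, of mass] sd D(3) by (simp add: mass_sum_wt)
  ultimately have "wt 1 e = wt 1 (nchoice (supp (\<partial> e)) (\<partial> e) ex)"
    using sd by (simp add: wt_nchoice)
  then show ?thesis by (simp add: wt_eq_iff)
qed

end
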